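(* Let $\alpha$ and $\beta$ be real numbers and let $n$ be a positive integer. For integers $j,k$ define $$d_{\alpha,\beta}(j,k)=\sqrt{\|(k-j)\alpha\|^2+\|(k-j)\beta\|^2},$$ where $\|x\|$ denotes the distance from $x$ to the nearest integer. Let $I^1_{j,k}$ be the geodesic joining $\{j\alpha\}$ and $\{k\alpha\}$, and $I^2_{j,k}$ the geodesic joining $\{j\beta\}$ and $\{k\beta\}$. Define $$S_{\alpha,\beta}(n)=\{d_{\alpha,\beta}(j,k) : 1\le j<k\le n,\ \text{and for all } 1\le p<q\le n \text{ with } d_{\alpha,\beta}(p,q)<d_{\alpha,\beta}(j,k) \text{ we have } I^1_{p,q}\cap I^1_{j,k}=\emptyset \text{ and } I^2_{p,q}\cap I^2_{j,k}=\emptyset\}.$$ Then $|S_{\alpha,\beta}(n)|\le 11$.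
   Context: $\{x\}$ denotes the fractional part of $x$. For two points $u,v\in[0,1)$, let $m=\min(u,v)$ and $M=\max(u,v)$; the geodesic joining $u$ and $v$ is the set $[m,M)$ if $M-m\le 1/2$, and the set $[0,m)\cup[M,1)$ otherwise. *)

theory Defs
  imports Complex_Main
begin

definition nearest_int_dist :: "real \<Rightarrow> real" where
  "nearest_int_dist x = \<bar>x - of_int (round x)\<bar>"

definition torus_dist :: "real \<Rightarrow> real \<Rightarrow> int \<Rightarrow> int \<Rightarrow> real" where
  "torus_dist \<alpha> \<beta> j k =
     sqrt ((nearest_int_dist (of_int (k - j) * \<alpha>))\<^sup>2 + (nearest_int_dist (of_int (k - j) * \<beta>))\<^sup>2)"

text \<open>Intended for points of \<open>[0,1)\<close>, regarded as the circle; empty if both points agree.\<close>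

definition geodesic :: "real \<Rightarrow> real \<Rightarrow> real set" where
  "geodesic u v =
     (let m = min u v; M = max u v
      in if M - m \<le> 1 / 2 then {m..<M} else {0..<m} \<union> {M..<1})"

definition orbit_geodesic :: "real \<Rightarrow> int \<Rightarrow> int \<Rightarrow> real set" where
  "orbit_geodesic \<theta> j k = geodesic (frac (of_int j * \<theta>)) (frac (of_int k * \<theta>))"

definition isolated_dists :: "real \<Rightarrow> real \<Rightarrow> nat \<Rightarrow> real set" where
  "isolated_dists \<alpha> \<beta> n =
     {torus_dist \<alpha> \<beta> j k | j k. 1 \<le> j \<and> j < k \<and> k \<le> int n \<and>
        (\<forall>p q. 1 \<le> p \<and> p < q \<and> q \<le> int n \<and> torus_dist \<alpha> \<beta> p q < torus_dist \<alpha> \<beta> j k \<longrightarrow>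
           orbit_geodesic \<alpha> p q \<inter> orbit_geodesic \<alpha> j k = {} \<and>
           orbit_geodesic \<beta> p q \<inter> orbit_geodesic \<beta> j k = {})}"

end

theory Submission
  imports Defs
begin

text \<open>The distance of \<open>j\<close> and \<open>k\<close> depends only on \<open>m = k - j\<close>, so one counts differences. Let \<open>r\<close> be
  a difference giving an element of \<open>S\<close> and let \<open>t\<close> be a shorter one. Geodesics of step \<open>t\<close> attached
  to the endpoints of a geodesic of step \<open>r\<close> must be disjoint from it, which forces
  \<open>2 t \<ge> n + 1 + r\<close> if a coordinate of the displacement of \<open>t\<close> has the same sign as that of \<open>r\<close>, and
  \<open>2 t \<ge> n + 1 - r\<close> if it has the opposite sign.

  Apply this to the longest \<open>r\<close> with nonzero coordinates. Two shorter elements \<open>t\<close>, \<open>t'\<close> with \<open>2 t, 2 t' \<ge> n + 1 + r\<close> have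
  a difference \<open>\<bar>t - t'\<bar>\<close> too small to be short, so their displacements lie in different 60 degree
  sectors: at most 6 of them. The remaining elements all lie in the quadrant opposite to \<open>r\<close>, and there
  at most one in each octant: the difference of two of them would be short and so again point into that
  quadrant, which makes the shorter of the two the longer one. Displacements with a vanishing coordinate are counted
  separately: if neither \<open>\<alpha>\<close> nor \<open>\<beta>\<close> has a period below \<open>n / 2\<close>, there is at most one for each
  coordinate, in total \<open>1 + 6 + 2 + 2 = 11\<close>. If, say, \<open>\<alpha>\<close> has such a period \<open>q\<close>, at most 3 elements
  have vanishing first coordinate, at most one has first coordinate one half, and the others below the
  longest exceed \<open>n - q\<close>, so again they lie in different sectors: \<open>3 + 1 + 1 + 6 = 11\<close>.\<close>

section \<open>The geometry of geodesics at an endpoint\<close>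

text \<open>The representative of \<open>x\<close> modulo 1 in \<open>[-1/2, 1/2)\<close>; a difference of exactly
  one half is always represented by \<open>-1/2\<close>, although its geodesic may lie on either side.\<close>

definition cent :: "real \<Rightarrow> real" where
  "cent x = x - of_int (round x)"

lemma nearest_int_dist_cent: "nearest_int_dist x = \<bar>cent x\<bar>"
  by (simp add: nearest_int_dist_def cent_def)

lemma cent_ge: "- 1 / 2 \<le> cent x" and cent_lt: "cent x < 1 / 2"
  using of_int_round_le[of x] of_int_round_gt[of x] by (auto simp: cent_def)

lemma cent_unique:
  assumes "x = y + of_int k" "- 1 / 2 \<le> y" "y < 1 / 2"
  shows "cent x = y"
proof -
  have "round x = k"
    unfolding round_def using assms by (intro floor_unique) auto
  then show ?thesis using assms by (simp add: cent_def)
qed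

lemma cent_expand: obtains k :: int where "x = cent x + of_int k"
  by (auto simp: cent_def)

lemma abs_cent_le:
  assumes "x = y + of_int k"
  shows "\<bar>cent x\<bar> \<le> \<bar>y\<bar>"
  using round_diff_minimal[of x k] assms by (simp add: cent_def)

lemma cent_add_left_zero:
  assumes "cent x = 0" shows "cent (x + y) = cent y"
proof -
  obtain k where k: "x = cent x + of_int k" by (rule cent_expand)
  obtain l where l: "y = cent y + of_int l" by (rule cent_expand)
  show ?thesis
    by (rule cent_unique[of _ _ "k + l"]) (use k l assms cent_ge[of y] cent_lt[of y] in auto)
qed

lemma cent_minus: "cent x \<noteq> - 1 / 2 \<Longrightarrow> cent (- x) = - cent x"
proof -
  assume a: "cent x \<noteq> - 1 / 2"
  obtain k where k: "x = cent x + of_int k" by (rule cent_expand)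
  show ?thesis
    by (rule cent_unique[of _ _ "- k"]) (use k a cent_ge[of x] cent_lt[of x] in auto)
qed

lemma cent_minus_half: "cent x = - 1 / 2 \<Longrightarrow> cent (- x) = - 1 / 2"
proof -
  assume a: "cent x = - 1 / 2"
  obtain k where k: "x = cent x + of_int k" by (rule cent_expand)
  show ?thesis
    by (rule cent_unique[of _ _ "1 - k"]) (use k a in auto)
qed

lemma abs_cent_minus: "\<bar>cent (- x)\<bar> = \<bar>cent x\<bar>"
  by (cases "cent x = - 1 / 2") (auto simp: cent_minus cent_minus_half)

lemma cent_diff:
  assumes "\<bar>cent x - cent y\<bar> < 1 / 2"
  shows "cent (x - y) = cent x - cent y"
proof -
  obtain k where k: "x = cent x + of_int k" by (rule cent_expand)
  obtain l where l: "y = cent y + of_int l" by (rule cent_expand)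
  show ?thesis
  proof (rule cent_unique[of _ _ "k - l"])
    show "x - y = cent x - cent y + of_int (k - l)" using k l by simp
    show "- 1 / 2 \<le> cent x - cent y" "cent x - cent y < 1 / 2" using assms by linarith+
  qed
qed

lemma abs_cent_diff_le: "\<bar>cent (x - y)\<bar> \<le> \<bar>cent x - cent y\<bar>"
proof -
  obtain k where k: "x = cent x + of_int k" by (rule cent_expand)
  obtain l where l: "y = cent y + of_int l" by (rule cent_expand)
  show ?thesis
    by (rule abs_cent_le[of _ _ "k - l"]) (use k l in auto)
qed

text \<open>\<open>side s a A\<close>: the set \<open>A\<close> of the circle leaves \<open>a\<close> to the right (\<open>s\<close> true) or to
  the left. The right side contains \<open>a\<close> itself since geodesics are half-open intervals.\<close>

definition side :: "bool \<Rightarrow> real \<Rightarrow> real set \<Rightarrow> bool" where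
  "side s a A = (if s then frac a \<in> A else (\<exists>e>0. \<forall>t. 0 < t \<and> t < e \<longrightarrow> frac (a - t) \<in> A))"

text \<open>All contradictions with disjointness, apart from that between two geodesics of length
  one half, arise this way: sets leaving one point on the same side overlap near it.\<close>

lemma side_meet:
  assumes "side s a A" "side s a B" shows "A \<inter> B \<noteq> {}"
proof (cases s)
  case True
  then show ?thesis using assms by (auto simp: side_def)
next
  case False
  then obtain e e' where e: "e > 0" "\<forall>t. 0 < t \<and> t < e \<longrightarrow> frac (a - t) \<in> A"
    and e': "e' > 0" "\<forall>t. 0 < t \<and> t < e' \<longrightarrow> frac (a - t) \<in> B"
    using assms by (auto simp: side_def)
  have "0 < min e e' / 2" "min e e' / 2 < e" "min e e' / 2 < e'" using e(1) e'(1) by auto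
  then show ?thesis using e(2) e'(2) by blast
qed

lemma frac_add_int: "frac (a + of_int k) = frac a"
  by (simp add: frac_def)

lemma side_add_int: "side s (a + of_int k) A = side s a A"
proof -
  have "frac (a + of_int k - t) = frac (a - t)" for t
    using frac_add_int[of "a - t" k] by (simp add: algebra_simps)
  then show ?thesis by (simp add: side_def frac_add_int)
qed

lemma geodesic_commute: "geodesic u v = geodesic v u"
  by (simp add: geodesic_def min.commute max.commute)

lemma frac_shift:
  assumes "0 \<le> frac a - t + of_int k" "frac a - t + of_int k < 1"
  shows "frac (a - t) = frac a - t + of_int k"
proof -
  have "\<lfloor>a - t\<rfloor> = \<lfloor>a\<rfloor> - k"
    using assms by (intro floor_unique) (auto simp: frac_def)
  then show ?thesis by (simp add: frac_def)
qed

lemma geodesic_side_pos: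
  assumes "cent (b - a) > 0"
  shows "side True a (geodesic (frac a) (frac b)) \<and> side False b (geodesic (frac a) (frac b))"
proof -
  define d where "d = cent (b - a)"
  have d: "0 < d" "d < 1 / 2" using assms cent_lt[of "b - a"] by (auto simp: d_def)
  obtain k where "b - a = d + of_int k" unfolding d_def by (rule cent_expand)
  then have ba: "frac b - frac a = d + of_int (k - \<lfloor>b\<rfloor> + \<lfloor>a\<rfloor>)" by (simp add: frac_def)
  define l where "l = k - \<lfloor>b\<rfloor> + \<lfloor>a\<rfloor>"
  have fr: "0 \<le> frac a" "frac a < 1" "0 \<le> frac b" "frac b < 1" by (auto simp: frac_lt_1)
  have ba: "frac b - frac a = d + of_int l" using ba by (simp add: l_def)
  \<comment> \<open>The arc from \<open>a\<close> to \<open>b\<close> either stays inside [0,1),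
    which is \<open>l = 0\<close>, or crosses the point 0, which is \<open>l = -1\<close>.\<close>
  have "real_of_int l < 1" "real_of_int l > -2" using ba fr d by linarith+
  then have "l = 0 \<or> l = -1" by auto
  then show ?thesis
  proof
    assume "l = 0"
    then have v: "frac b = frac a + d" using ba by simp
    have G: "geodesic (frac a) (frac b) = {frac a..<frac b}"
      using v d by (simp add: geodesic_def Let_def)
    have "frac (b - t) \<in> {frac a..<frac b}" if "0 < t" "t < d" for t
      using frac_shift[of b t 0] that v fr by auto
    then show ?thesis unfolding G side_def using v d by auto
  next
    assume "l = -1"
    then have v: "frac b = frac a + d - 1" using ba by simp
    have G: "geodesic (frac a) (frac b) = {0..<frac b} \<union> {frac a..<1}"
      using v d by (simp add: geodesic_def Let_def)
    have "frac (b - t) \<in> {0..<frac b} \<union> {frac a..<1}" if "0 < t" "t < d" for t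
    proof (cases "t \<le> frac b")
      case True
      then show ?thesis using frac_shift[of b t 0] that fr by auto
    next
      case False
      then show ?thesis using frac_shift[of b t 1] that fr v by auto
    qed
    then show ?thesis unfolding G side_def using fr d by auto
  qed
qed

text \<open>At distance exactly one half \<open>geodesic\<close> takes its first branch and never
  crosses 0. So its side at \<open>a\<close> depends on the order of the fractional parts, which
  \<open>cent\<close> does not record.\<close>

lemma geodesic_half:
  assumes "cent (b - a) = - 1 / 2"
  shows "(frac b = frac a + 1 / 2 \<and> geodesic (frac a) (frac b) = {frac a..<frac b})
    \<or> (frac a = frac b + 1 / 2 \<and> geodesic (frac a) (frac b) = {frac b..<frac a})"
proof -
  obtain k where "b - a = cent (b - a) + of_int k" by (rule cent_expand)
  then have ba: "frac b - frac a = - 1 / 2 + of_int (k - \<lfloor>b\<rfloor> + \<lfloor>a\<rfloor>)"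
    using assms by (simp add: frac_def)
  define l where "l = k - \<lfloor>b\<rfloor> + \<lfloor>a\<rfloor>"
  have fr: "0 \<le> frac a" "frac a < 1" "0 \<le> frac b" "frac b < 1" by (auto simp: frac_lt_1)
  have ba: "frac b - frac a = - 1 / 2 + of_int l" using ba by (simp add: l_def)
  have "real_of_int l < 2" "real_of_int l > -1" using ba fr by linarith+
  then have "l = 0 \<or> l = 1" by auto
  then show ?thesis using ba by (auto simp: geodesic_def Let_def)
qed

lemma geodesic_side_half:
  assumes "cent (b - a) = - 1 / 2"
  shows "\<exists>s. side s a (geodesic (frac a) (frac b)) \<and> side (\<not> s) b (geodesic (frac a) (frac b))"
proof -
  have fr: "0 \<le> frac a" "frac a < 1" "0 \<le> frac b" "frac b < 1" by (auto simp: frac_lt_1)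
  have *: "side True x {frac x..<frac y}" "side False y {frac x..<frac y}"
    if "frac y = frac x + 1 / 2" for x y
  proof -
    show "side True x {frac x..<frac y}" using that by (simp add: side_def)
    have "frac (y - t) \<in> {frac x..<frac y}" if "0 < t" "t < 1 / 2" for t
      using frac_shift[of y t 0] that \<open>frac y = frac x + 1 / 2\<close> frac_ge_0[of x] frac_lt_1[of y] by auto
    then show "side False y {frac x..<frac y}"
      unfolding side_def by (auto intro!: exI[of _ "1 / 2"])
  qed
  show ?thesis
    using geodesic_half[OF assms]
  proof (elim disjE conjE)
    assume "frac b = frac a + 1 / 2" "geodesic (frac a) (frac b) = {frac a..<frac b}"
    then show ?thesis using *[of b a] by (intro exI[of _ True]) simp
  next
    assume "frac a = frac b + 1 / 2" "geodesic (frac a) (frac b) = {frac b..<frac a}"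
    then show ?thesis using *[of a b] by (intro exI[of _ False]) simp
  qed
qed

lemma geodesic_side:
  assumes "cent (b - a) \<noteq> 0"
  shows "\<exists>s. side s a (geodesic (frac a) (frac b)) \<and> side (\<not> s) b (geodesic (frac a) (frac b))
    \<and> (cent (b - a) \<noteq> - 1 / 2 \<longrightarrow> s = (cent (b - a) > 0))"
proof -
  consider "cent (b - a) > 0" | "cent (b - a) = - 1 / 2" | "cent (b - a) < 0" "cent (b - a) \<noteq> - 1 / 2"
    using assms by linarith
  then show ?thesis
  proof cases
    case 1
    then show ?thesis using geodesic_side_pos[of b a] by (intro exI[of _ True]) simp
  next
    case 2
    then show ?thesis using geodesic_side_half[of b a] by auto
  next
    case 3
    then have "cent (a - b) > 0" using cent_minus[of "b - a"] by simp
    then show ?thesis using geodesic_side_pos[of a b] 3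
      by (intro exI[of _ False]) (simp add: geodesic_commute)
  qed
qed

text \<open>Both intervals start below 1/2 and have length 1/2, so each contains the larger of the
  two left endpoints.\<close>

lemma half_geodesics_meet:
  assumes "cent (b - a) = - 1 / 2" "cent (b' - a') = - 1 / 2"
  shows "geodesic (frac a) (frac b) \<inter> geodesic (frac a') (frac b') \<noteq> {}"
proof -
  have *: "\<exists>m. 0 \<le> m \<and> m < 1 / 2 \<and> geodesic (frac x) (frac y) = {m..<m + 1 / 2}"
    if "cent (y - x) = - 1 / 2" for x y
    using geodesic_half[OF that]
  proof (elim disjE conjE)
    assume "frac y = frac x + 1 / 2" "geodesic (frac x) (frac y) = {frac x..<frac y}"
    then show ?thesis using frac_lt_1[of y] by (intro exI[of _ "frac x"]) simp
  next
    assume "frac x = frac y + 1 / 2" "geodesic (frac x) (frac y) = {frac y..<frac x}"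
    then show ?thesis using frac_lt_1[of x] by (intro exI[of _ "frac y"]) simp
  qed
  obtain m m' where m: "0 \<le> m" "m < 1 / 2" "geodesic (frac a) (frac b) = {m..<m + 1 / 2}"
    and m': "0 \<le> m'" "m' < 1 / 2" "geodesic (frac a') (frac b') = {m'..<m' + 1 / 2}"
    using *[OF assms(1)] *[OF assms(2)] by auto
  have "max m m' \<in> {m..<m + 1 / 2} \<inter> {m'..<m' + 1 / 2}" using m m' by auto
  then show ?thesis unfolding m m' by blast
qed

section \<open>Squared lengths and the inequalities forced by isolation\<close>

definition sqlen :: "real \<Rightarrow> real \<Rightarrow> int \<Rightarrow> real" where
  "sqlen \<alpha> \<beta> t = (cent (of_int t * \<alpha>))\<^sup>2 + (cent (of_int t * \<beta>))\<^sup>2"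

lemma torus_dist_sqlen: "torus_dist \<alpha> \<beta> j k = sqrt (sqlen \<alpha> \<beta> (k - j))"
  by (simp add: torus_dist_def sqlen_def nearest_int_dist_cent)

lemma sqlen_swap: "sqlen \<alpha> \<beta> t = sqlen \<beta> \<alpha> t"
  by (simp add: sqlen_def)

lemma sqlen_minus: "sqlen \<alpha> \<beta> (- t) = sqlen \<alpha> \<beta> t"
proof -
  have "(cent (- x))\<^sup>2 = (cent x)\<^sup>2" for x
    using abs_cent_minus[of x] by (metis power2_abs)
  then show ?thesis by (simp add: sqlen_def)
qed

lemma sqlen_diff_le:
  "sqlen \<alpha> \<beta> (t - u) \<le> (cent (of_int t * \<alpha>) - cent (of_int u * \<alpha>))\<^sup>2
     + (cent (of_int t * \<beta>) - cent (of_int u * \<beta>))\<^sup>2"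
  unfolding sqlen_def of_int_diff left_diff_distrib
  by (intro add_mono) (use abs_cent_diff_le in \<open>auto simp: abs_le_square_iff[symmetric]\<close>)

lemma sqlen_le_half: "sqlen \<alpha> \<beta> t \<le> 1 / 2"
proof -
  have "(cent x)\<^sup>2 \<le> (1 / 2)\<^sup>2" for x
    using cent_ge[of x] cent_lt[of x] by (intro power2_le_iff_abs_le[THEN iffD2]) auto
  from this[of "of_int t * \<alpha>"] this[of "of_int t * \<beta>"] show ?thesis
    by (simp add: sqlen_def power2_eq_square)
qed

text \<open>The distance of a pair depends only on \<open>m\<close>, but its isolation also on its
  position; hence \<open>j\<close> is quantified inside, and differences rather than pairs are
  counted.\<close>

definition isolated_diff :: "real \<Rightarrow> real \<Rightarrow> nat \<Rightarrow> int \<Rightarrow> bool" where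
  "isolated_diff \<alpha> \<beta> n m \<longleftrightarrow> (\<exists>j. 1 \<le> j \<and> 0 < m \<and> j + m \<le> int n \<and>
     (\<forall>p t. 1 \<le> p \<and> 0 < t \<and> p + t \<le> int n \<and> sqlen \<alpha> \<beta> t < sqlen \<alpha> \<beta> m \<longrightarrow>
        orbit_geodesic \<alpha> p (p + t) \<inter> orbit_geodesic \<alpha> j (j + m) = {} \<and>
        orbit_geodesic \<beta> p (p + t) \<inter> orbit_geodesic \<beta> j (j + m) = {}))"

lemma isolated_diff_swap: "isolated_diff \<alpha> \<beta> n m \<Longrightarrow> isolated_diff \<beta> \<alpha> n m"
  unfolding isolated_diff_def sqlen_swap[of \<beta> \<alpha>] by blast

lemma isolated_diff_range: "isolated_diff \<alpha> \<beta> n m \<Longrightarrow> 0 < m \<and> m < int n"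
  by (auto simp: isolated_diff_def)

lemma orbit_geodesic_side:
  assumes "cent (of_int t * \<theta>) \<noteq> 0"
  shows "\<exists>s. side s (of_int p * \<theta>) (orbit_geodesic \<theta> p (p + t)) \<and>
             side (\<not> s) (of_int (p + t) * \<theta>) (orbit_geodesic \<theta> p (p + t))
    \<and> (cent (of_int t * \<theta>) \<noteq> - 1 / 2 \<longrightarrow> s = (cent (of_int t * \<theta>) > 0))"
  using geodesic_side[of "of_int (p + t) * \<theta>" "of_int p * \<theta>"] assms
  by (simp add: orbit_geodesic_def algebra_simps)

text \<open>A shorter multiple \<open>t\<close> with the same sign may be attached neither to the right of \<open>j\<close> nor to the
  left of \<open>j + m\<close>, one with opposite sign neither to the left of \<open>j\<close> nor to the right of \<open>j + m\<close>.
  So these places must lie outside \<open>{1..n}\<close>.\<close>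

lemma isolated_diff_bound:
  assumes "isolated_diff \<alpha> \<beta> n m" "cent (of_int m * \<alpha>) \<noteq> 0"
  shows "\<exists>s. (cent (of_int m * \<alpha>) \<noteq> - 1 / 2 \<longrightarrow> s = (cent (of_int m * \<alpha>) > 0)) \<and>
    (\<forall>t. 0 < t \<and> sqlen \<alpha> \<beta> t < sqlen \<alpha> \<beta> m \<and>
         cent (of_int t * \<alpha>) \<noteq> 0 \<and> cent (of_int t * \<alpha>) \<noteq> - 1 / 2 \<longrightarrow>
       2 * t \<ge> int n + 1 + (if s = (cent (of_int t * \<alpha>) > 0) then m else - m))"
proof -
  obtain j where j: "1 \<le> j" "0 < m" "j + m \<le> int n"
    and disj: "\<And>p t. 1 \<le> p \<Longrightarrow> 0 < t \<Longrightarrow> p + t \<le> int n \<Longrightarrow> sqlen \<alpha> \<beta> t < sqlen \<alpha> \<beta> m \<Longrightarrow>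
        orbit_geodesic \<alpha> p (p + t) \<inter> orbit_geodesic \<alpha> j (j + m) = {}"
    using assms(1) unfolding isolated_diff_def by blast
  obtain s where s: "side s (of_int j * \<alpha>) (orbit_geodesic \<alpha> j (j + m))"
    "side (\<not> s) (of_int (j + m) * \<alpha>) (orbit_geodesic \<alpha> j (j + m))"
    "cent (of_int m * \<alpha>) \<noteq> - 1 / 2 \<longrightarrow> s = (cent (of_int m * \<alpha>) > 0)"
    using orbit_geodesic_side[OF assms(2)] by blast
  have "2 * t \<ge> int n + 1 + (if s = (cent (of_int t * \<alpha>) > 0) then m else - m)"
    if t: "0 < t" "sqlen \<alpha> \<beta> t < sqlen \<alpha> \<beta> m"
      "cent (of_int t * \<alpha>) \<noteq> 0" "cent (of_int t * \<alpha>) \<noteq> - 1 / 2" for t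
  proof -
    define z where "z = (cent (of_int t * \<alpha>) > 0)"
    have z: "side z (of_int p * \<alpha>) (orbit_geodesic \<alpha> p (p + t))"
      "side (\<not> z) (of_int (p + t) * \<alpha>) (orbit_geodesic \<alpha> p (p + t))" for p
      using orbit_geodesic_side[OF t(3), of p] t(4) by (auto simp: z_def)
    show ?thesis
    proof (cases "s = z")
      case True
      have "\<not> j + t \<le> int n"
        using side_meet[OF z(1)[of j], of "orbit_geodesic \<alpha> j (j + m)"] s(1) True
          disj[of j t] j t by auto
      moreover have "\<not> 1 \<le> j + m - t"
        using side_meet[OF z(2)[of "j + m - t"], of "orbit_geodesic \<alpha> j (j + m)"] s(2) True
          disj[of "j + m - t" t] j t by auto
      \<comment> \<open>Adding \<open>j + t \<ge> n + 1\<close> and \<open>t \<ge> j + m\<close>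
        cancels the position \<open>j\<close>. In the other case the same happens with
        \<open>t \<ge> j\<close> and \<open>j + m + t \<ge> n + 1\<close>.\<close>
      ultimately show ?thesis using True unfolding z_def[symmetric] by auto
    next
      case False
      then have sz: "s = (\<not> z)" "z = (\<not> s)" by auto
      have "\<not> 1 \<le> j - t"
        using side_meet[OF z(2)[of "j - t"], of "orbit_geodesic \<alpha> j (j + m)"] s(1) sz(1)
          disj[of "j - t" t] j t by auto
      moreover have "\<not> j + m + t \<le> int n"
        using side_meet[OF z(1)[of "j + m"], of "orbit_geodesic \<alpha> j (j + m)"] s(2) sz(2)
          disj[of "j + m" t] j t by auto
      ultimately show ?thesis using False unfolding z_def[symmetric] by auto
    qed
  qed
  then show ?thesis using s(3) by blast
qed

lemma cent_zero_int: "cent x = 0 \<Longrightarrow> \<exists>k::int. x = of_int k"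
  by (auto simp: cent_def)

text \<open>If \<open>t \<le> n - q\<close>, periodicity makes geodesics of step \<open>t\<close> leave every orbit point
  on both sides.\<close>

lemma isolated_diff_period_bound:
  assumes "isolated_diff \<alpha> \<beta> n m" "cent (of_int m * \<alpha>) \<noteq> 0"
    and q: "0 < q" "cent (of_int q * \<alpha>) = 0"
    and t: "0 < t" "sqlen \<alpha> \<beta> t < sqlen \<alpha> \<beta> m"
      "cent (of_int t * \<alpha>) \<noteq> 0" "cent (of_int t * \<alpha>) \<noteq> - 1 / 2"
  shows "int n - q < t"
proof (rule ccontr)
  assume le: "\<not> int n - q < t"
  obtain j where j: "1 \<le> j" "0 < m" "j + m \<le> int n"
    and disj: "\<And>p t. 1 \<le> p \<Longrightarrow> 0 < t \<Longrightarrow> p + t \<le> int n \<Longrightarrow> sqlen \<alpha> \<beta> t < sqlen \<alpha> \<beta> m \<Longrightarrow>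
        orbit_geodesic \<alpha> p (p + t) \<inter> orbit_geodesic \<alpha> j (j + m) = {}"
    using assms(1) unfolding isolated_diff_def by blast
  obtain s where s: "side s (of_int j * \<alpha>) (orbit_geodesic \<alpha> j (j + m))"
    using orbit_geodesic_side[OF assms(2)] by blast
  define z where "z = (cent (of_int t * \<alpha>) > 0)"
  have z: "side z (of_int p * \<alpha>) (orbit_geodesic \<alpha> p (p + t))"
    "side (\<not> z) (of_int (p + t) * \<alpha>) (orbit_geodesic \<alpha> p (p + t))" for p
    using orbit_geodesic_side[OF t(3), of p] t(4) by (auto simp: z_def)
  obtain c where c: "of_int q * \<alpha> = of_int c" using cent_zero_int[OF q(2)] by auto
  \<comment> \<open>As \<open>q * \<alpha>\<close> is an integer, indices matter only modulo
    \<open>q\<close>: \<open>i\<close> may be moved into the window from \<open>1 + u\<close> to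
    \<open>q + u\<close>. A geodesic of step \<open>t\<close> inside \<open>{1..n}\<close> can start
    there if \<open>u = 0\<close>, and end there if \<open>u = t\<close>.\<close>
  have per: "side b (of_int i * \<alpha>) A = side b (of_int (1 + (i - 1 - u) mod q + u) * \<alpha>) A" for b i A u
  proof -
    have eq: "i = 1 + (i - 1 - u) mod q + u + q * ((i - 1 - u) div q)"
      by (simp add: algebra_simps)
    have "of_int i * \<alpha> = of_int (1 + (i - 1 - u) mod q + u) * \<alpha> + of_int (c * ((i - 1 - u) div q))"
      by (subst eq, unfold of_int_add of_int_mult c[symmetric]) (simp add: algebra_simps)
    then show ?thesis by (simp only: side_add_int)
  qed
  have rng: "1 \<le> 1 + x mod q" "1 + x mod q + t \<le> int n" for x
    using le pos_mod_sign[OF q(1), of x] pos_mod_bound[OF q(1), of x] by linarith+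
  show False
  proof (cases "s = z")
    case True
    have "side s (of_int (1 + (j - 1) mod q) * \<alpha>) (orbit_geodesic \<alpha> j (j + m))"
      using s per[of s j _ 0] by simp
    from side_meet[OF this z(1)[folded True]] disj[OF rng(1) t(1) rng(2) t(2)]
    show False by blast
  next
    case False
    then have sz: "s = (\<not> z)" by auto
    have "side s (of_int (1 + (j - 1 - t) mod q + t) * \<alpha>) (orbit_geodesic \<alpha> j (j + m))"
      using s per[of s j _ t] by simp
    from side_meet[OF this z(2)[folded sz]] disj[OF rng(1) t(1) rng(2) t(2)]
    show False by blast
  qed
qed

text \<open>Geodesics of length one half always meet, so a strictly shorter such difference would
  destroy the isolation of the longer one.\<close>

lemma isolated_diff_half_unique:
  assumes "isolated_diff \<alpha> \<beta> n m" "isolated_diff \<alpha> \<beta> n m'"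
    and "cent (of_int m * \<alpha>) = - 1 / 2" "cent (of_int m' * \<alpha>) = - 1 / 2"
  shows "sqlen \<alpha> \<beta> m = sqlen \<alpha> \<beta> m'"
proof -
  have False if m: "isolated_diff \<alpha> \<beta> n m" "isolated_diff \<alpha> \<beta> n m'"
    "cent (of_int m * \<alpha>) = - 1 / 2" "cent (of_int m' * \<alpha>) = - 1 / 2"
    "sqlen \<alpha> \<beta> m' < sqlen \<alpha> \<beta> m" for m m'
  proof -
    obtain j where j: "1 \<le> j" "0 < m" "j + m \<le> int n"
      and disj: "\<And>p t. 1 \<le> p \<Longrightarrow> 0 < t \<Longrightarrow> p + t \<le> int n \<Longrightarrow> sqlen \<alpha> \<beta> t < sqlen \<alpha> \<beta> m \<Longrightarrow>
          orbit_geodesic \<alpha> p (p + t) \<inter> orbit_geodesic \<alpha> j (j + m) = {}"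
      using m(1) unfolding isolated_diff_def by blast
    obtain i where "1 \<le> i" "0 < m'" "i + m' \<le> int n"
      using m(2) unfolding isolated_diff_def by blast
    from disj[OF this m(5)] show False
      using half_geodesics_meet[of "of_int (i + m') * \<alpha>" "of_int i * \<alpha>"
          "of_int (j + m) * \<alpha>" "of_int j * \<alpha>"] m(3,4)
      by (simp add: orbit_geodesic_def algebra_simps)
  qed
  from this[of m m'] this[of m' m] assms show ?thesis by (meson linorder_cases)
qed

section \<open>Sectors and octants of the plane\<close>

text \<open>The form is the squared norm in coordinates along unit vectors at 60 degrees.
  Differences of equal sign are dominated by the larger vector; for opposite signs the mixed term
  becomes negative.\<close>

lemma hex_form_diff_less:
  fixes u v :: real
  assumes "0 \<le> u" "0 \<le> v" "0 \<le> u'" "0 \<le> v'"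
    and "u\<^sup>2 + u * v + v\<^sup>2 < r" "u'\<^sup>2 + u' * v' + v'\<^sup>2 < r"
  shows "(u - u')\<^sup>2 + (u - u') * (v - v') + (v - v')\<^sup>2 < r"
proof -
  have main: "(u - u')\<^sup>2 + (u - u') * (v - v') + (v - v')\<^sup>2 < r"
    if uu: "u' \<le> u" and n: "0 \<le> v" "0 \<le> u'" "0 \<le> v'"
      and r: "u\<^sup>2 + u * v + v\<^sup>2 < r" "u'\<^sup>2 + u' * v' + v'\<^sup>2 < r" for u v u' v' :: real
  proof -
    have sq: "x\<^sup>2 \<le> y\<^sup>2" if "0 \<le> x" "x \<le> y" for x y :: real
      using that by (rule power_mono[rotated])
    have uv: "0 \<le> u * v" "0 \<le> u' * v'" using uu n by auto
    show ?thesis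
    proof (cases "v' \<le> v")
      case True
      have "(u - u') * (v - v') \<le> u * v" using uu n True by (intro mult_mono) auto
      moreover have "(u - u')\<^sup>2 \<le> u\<^sup>2" "(v - v')\<^sup>2 \<le> v\<^sup>2"
        using uu n True by (auto intro!: sq)
      ultimately show ?thesis using r by linarith
    next
      case False
      define a b where "a = u - u'" and "b = v' - v"
      have ab: "0 \<le> a" "0 \<le> b" "a \<le> u" "b \<le> v'" using uu n False by (auto simp: a_def b_def)
      \<comment> \<open>The mixed term \<open>a * b\<close> is at least the square of the smaller of
        \<open>a\<close> and \<open>b\<close>.\<close>
      have "a\<^sup>2 - a * b + b\<^sup>2 \<le> max (a\<^sup>2) (b\<^sup>2)"
      proof (cases "a \<le> b")
        case True
        then have "a * a \<le> a * b" using ab by (intro mult_left_mono) auto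
        then show ?thesis by (simp add: power2_eq_square)
      next
        case False
        then have "b * b \<le> a * b" using ab by (intro mult_right_mono) auto
        then show ?thesis by (simp add: power2_eq_square)
      qed
      moreover have "a\<^sup>2 \<le> u\<^sup>2" "b\<^sup>2 \<le> v'\<^sup>2" using ab by (auto intro!: sq)
      moreover have "0 \<le> v\<^sup>2" "0 \<le> u'\<^sup>2" by auto
      ultimately have "a\<^sup>2 - a * b + b\<^sup>2 < r" using r uv by linarith
      then show ?thesis by (simp add: a_def b_def power2_eq_square algebra_simps)
    qed
  qed
  show ?thesis
  proof (cases "u' \<le> u")
    case True
    then show ?thesis using main assms by blast
  next
    case False
    then have "(u' - u)\<^sup>2 + (u' - u) * (v' - v) + (v' - v)\<^sup>2 < r" using main[of u u' v' v] assms by auto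
    then show ?thesis by (simp add: power2_eq_square algebra_simps)
  qed
qed

text \<open>The six half-open sectors of angle 60 degrees cut out by the vertical axis and the lines
  \<open>x = \<plusminus>\<surd>3 y\<close>. In coordinates along the two bounding rays of a sector the squared norm is the form
  \<open>u\<^sup>2 + u v + v\<^sup>2\<close>.\<close>

definition sector :: "real \<Rightarrow> real \<Rightarrow> bool \<times> bool \<times> bool" where
  "sector x y = (0 < x, x \<le> sqrt 3 * y, - x \<le> sqrt 3 * y)"

text \<open>The two removed triples are contradictory: their last two conditions give
  \<open>x < 0\<close> and \<open>0 < x\<close> respectively. Six real sectors remain.\<close>

definition sectors :: "(bool \<times> bool \<times> bool) set" where
  "sectors = UNIV - {(True, True, False), (False, False, True)}"

lemma sector_in_sectors: "sector x y \<in> sectors"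
  by (auto simp: sector_def sectors_def)

lemma card_sectors: "finite sectors" "card sectors = 6"
proof -
  have eq: "sectors = {(True, True, True), (True, False, True), (True, False, False),
    (False, True, True), (False, True, False), (False, False, False)}"
    by (auto simp: sectors_def)
  show "finite sectors" "card sectors = 6" unfolding eq by simp_all
qed

lemma sector_diff_less:
  assumes s: "sector x y = sector x' y'" and r: "x\<^sup>2 + y\<^sup>2 < r" "x'\<^sup>2 + y'\<^sup>2 < r"
  shows "(x - x')\<^sup>2 + (y - y')\<^sup>2 < r"
proof -
  \<comment> \<open>Scaling by the root of 3 turns the squared norm into
    \<open>3 * x^2 + z^2\<close>, and the coordinates along the bounding rays become integer
    combinations of \<open>x\<close> and \<open>z\<close>.\<close>
  define z z' where "z = sqrt 3 * y" and "z' = sqrt 3 * y'"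
  have z2: "z\<^sup>2 = 3 * y\<^sup>2" "z'\<^sup>2 = 3 * y'\<^sup>2" "(z - z')\<^sup>2 = 3 * (y - y')\<^sup>2"
    by (simp_all add: z_def z'_def power_mult_distrib flip: right_diff_distrib)
  have R: "3 * x\<^sup>2 + z\<^sup>2 < 3 * r" "3 * x'\<^sup>2 + z'\<^sup>2 < 3 * r" using r by (simp_all add: z2)
  have sg: "(0 < x) = (0 < x')" "(x \<le> z) = (x' \<le> z')" "(- x \<le> z) = (- x' \<le> z')"
    using s by (simp_all add: sector_def z_def z'_def)
  have form: "(u - u')\<^sup>2 + (u - u') * (v - v') + (v - v')\<^sup>2 < 3 * r"
    if "0 \<le> u" "0 \<le> v" "0 \<le> u'" "0 \<le> v'"
      "u\<^sup>2 + u * v + v\<^sup>2 = 3 * x\<^sup>2 + z\<^sup>2" "u'\<^sup>2 + u' * v' + v'\<^sup>2 = 3 * x'\<^sup>2 + z'\<^sup>2" for u v u' v'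
    using hex_form_diff_less[of u v u' v' "3 * r"] that R by simp
  have "3 * (x - x')\<^sup>2 + (z - z')\<^sup>2 < 3 * r"
  proof (cases "0 < x"; cases "x \<le> z"; cases "- x \<le> z")
    assume "0 < x" "x \<le> z" "- x \<le> z"
    then show ?thesis using form[of "2 * x" "z - x" "2 * x'" "z' - x'"] sg
      by (simp add: power2_eq_square algebra_simps)
  next
    assume "0 < x" "\<not> x \<le> z" "- x \<le> z"
    then show ?thesis using form[of "x - z" "x + z" "x' - z'" "x' + z'"] sg
      by (simp add: power2_eq_square algebra_simps)
  next
    assume "0 < x" "\<not> x \<le> z" "\<not> - x \<le> z"
    then show ?thesis using form[of "2 * x" "- (x + z)" "2 * x'" "- (x' + z')"] sg
      by (simp add: power2_eq_square algebra_simps)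
  next
    assume "\<not> 0 < x" "x \<le> z" "- x \<le> z"
    then show ?thesis using form[of "- 2 * x" "x + z" "- 2 * x'" "x' + z'"] sg
      by (simp add: power2_eq_square algebra_simps)
  next
    assume "\<not> 0 < x" "x \<le> z" "\<not> - x \<le> z"
    then show ?thesis using form[of "z - x" "- x - z" "z' - x'" "- x' - z'"] sg
      by (simp add: power2_eq_square algebra_simps)
  next
    assume "\<not> 0 < x" "\<not> x \<le> z" "\<not> - x \<le> z"
    then show ?thesis using form[of "- 2 * x" "x - z" "- 2 * x'" "x' - z'"] sg
      by (simp add: power2_eq_square algebra_simps)
  qed (use sg in auto)
  then show ?thesis by (simp add: z2)
qed

text \<open>The claim amounts to \<open>a^2 + b^2 < 2 * (a * c + b * d)\<close>. It holds since
  vectors in one octant enclose at most 45 degrees and (c, d) is the longer one.\<close>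

lemma octant_diff_less:
  fixes a b c d :: real
  assumes "0 < a" "0 < b" "b \<le> a" "0 < c" "0 < d" "d \<le> c" "a\<^sup>2 + b\<^sup>2 < c\<^sup>2 + d\<^sup>2"
  shows "(a - c)\<^sup>2 + (b - d)\<^sup>2 < c\<^sup>2 + d\<^sup>2"
proof (cases "a \<le> c")
  case True
  have "a * a \<le> a * c" "b * b \<le> a * a" using assms True by (auto intro!: mult_left_mono mult_mono)
  moreover have "0 < b * d" using assms by simp
  ultimately show ?thesis by (simp add: power2_eq_square algebra_simps)
next
  case False
  have "c\<^sup>2 < a\<^sup>2" using False assms by (intro power_strict_mono) auto
  then have "b\<^sup>2 < d\<^sup>2" using assms by linarith
  then have bd: "b < d" using assms by (meson less_imp_le power_less_imp_less_base)
  then have "b * b < b * d" using assms by simp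
  moreover have "d\<^sup>2 \<le> c\<^sup>2" using assms by (intro power_mono) auto
  then have "a\<^sup>2 < 4 * c\<^sup>2" using assms(7) zero_le_power2[of b] zero_le_power2[of c] by linarith
  then have "a\<^sup>2 < (2 * c)\<^sup>2" by (simp add: power_mult_distrib)
  then have "a < 2 * c" using assms by (intro power_less_imp_less_base[of a 2 "2 * c"]) auto
  then have "a * a < a * (2 * c)" using assms by (intro mult_strict_left_mono) auto
  moreover have "0 < b * d" using assms by simp
  ultimately show ?thesis by (simp add: power2_eq_square algebra_simps)
qed

section \<open>Elements in a common octant\<close>

text \<open>For these values the sign alone decides on which side a geodesic leaves; excluded are
  empty geodesics and the ambiguous ones of length one half.\<close>

abbreviation regular :: "real \<Rightarrow> bool" where
  "regular x \<equiv> cent x \<noteq> 0 \<and> cent x \<noteq> - 1 / 2"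

lemma abs_cent_le_half: "\<bar>cent x\<bar> \<le> 1 / 2"
  using cent_ge[of x] cent_lt[of x] by linarith

lemma abs_cent_half: "\<bar>cent x\<bar> = 1 / 2 \<Longrightarrow> cent x = - 1 / 2"
  using cent_lt[of x] by linarith

lemma abs_cent_less_half: "cent x \<noteq> - 1 / 2 \<Longrightarrow> \<bar>cent x\<bar> < 1 / 2"
  using abs_cent_half[of x] abs_cent_le_half[of x] by linarith

lemma abs_diff_less_if_same_sign:
  fixes a b c :: real
  assumes "\<bar>a\<bar> < c" "\<bar>b\<bar> < c" "(0 < a) = (0 < b)"
  shows "\<bar>a - b\<bar> < c"
  using assms by linarith

lemma sqlen_not_both_half:
  assumes "sqlen \<alpha> \<beta> t < sqlen \<alpha> \<beta> r"
  shows "\<not> (cent (of_int t * \<alpha>) = - 1 / 2 \<and> cent (of_int t * \<beta>) = - 1 / 2)"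
proof
  assume "cent (of_int t * \<alpha>) = - 1 / 2 \<and> cent (of_int t * \<beta>) = - 1 / 2"
  then have "sqlen \<alpha> \<beta> t = 1 / 2" by (simp add: sqlen_def power2_eq_square)
  then show False using assms sqlen_le_half[of \<alpha> \<beta> r] by simp
qed

text \<open>Two coordinates of size one half would give the maximal length, so the shorter
  \<open>t\<close> has a regular coordinate. Whatever its sign, the weaker of the two bounds
  holds.\<close>

lemma short_multiple_bound:
  assumes r: "isolated_diff \<alpha> \<beta> n r" "cent (of_int r * \<alpha>) \<noteq> 0" "cent (of_int r * \<beta>) \<noteq> 0"
    and t: "0 < t" "sqlen \<alpha> \<beta> t < sqlen \<alpha> \<beta> r"
    and nz: "cent (of_int t * \<alpha>) \<noteq> 0" "cent (of_int t * \<beta>) \<noteq> 0"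
  shows "int n + 1 - r \<le> 2 * t"
proof -
  have r0: "0 < r" using isolated_diff_range[OF r(1)] by simp
  consider "regular (of_int t * \<alpha>)" | "regular (of_int t * \<beta>)"
    using sqlen_not_both_half[OF t(2)] nz by blast
  then show ?thesis
  proof cases
    case 1
    then show ?thesis using isolated_diff_bound[OF r(1,2)] t r0 by (smt (verit))
  next
    case 2
    have "sqlen \<beta> \<alpha> t < sqlen \<beta> \<alpha> r" using t(2) by (simp add: sqlen_swap)
    then show ?thesis using isolated_diff_bound[OF isolated_diff_swap[OF r(1)] r(3)] t(1) 2 r0
      by (smt (verit))
  qed
qed

text \<open>Both \<open>k\<close> and \<open>i\<close> are too small to share a direction with
  \<open>r\<close>, so they point the opposite way. Isolation of \<open>k\<close> makes
  \<open>i\<close> larger than \<open>k\<close>, and \<open>i - k\<close> is short and small, hence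
  also points the opposite way. So neither coordinate of \<open>i\<close> is smaller in size than
  that of \<open>k\<close>, although \<open>i\<close> is shorter.\<close>

lemma octant_absurd:
  assumes r: "isolated_diff \<alpha> \<beta> n r" "cent (of_int r * \<alpha>) \<noteq> 0" "cent (of_int r * \<beta>) \<noteq> 0"
    and k: "isolated_diff \<alpha> \<beta> n k" "cent (of_int k * \<alpha>) \<noteq> 0" "cent (of_int k * \<beta>) \<noteq> 0"
      "2 * k \<le> int n + r" "\<bar>cent (of_int k * \<beta>)\<bar> \<le> \<bar>cent (of_int k * \<alpha>)\<bar>"
    and i: "0 < i" "cent (of_int i * \<alpha>) \<noteq> 0" "cent (of_int i * \<beta>) \<noteq> 0"
      "2 * i \<le> int n + r" "\<bar>cent (of_int i * \<beta>)\<bar> \<le> \<bar>cent (of_int i * \<alpha>)\<bar>"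
    and less: "sqlen \<alpha> \<beta> i < sqlen \<alpha> \<beta> k" "sqlen \<alpha> \<beta> k < sqlen \<alpha> \<beta> r"
  shows False
proof -
  define x y where "x = (\<lambda>t::int. of_int t * \<alpha>)" and "y = (\<lambda>t::int. of_int t * \<beta>)"
  have xdef: "of_int t * \<alpha> = x t" "of_int t * \<beta> = y t" for t :: int by (simp_all add: x_def y_def)
  have sql: "sqlen \<alpha> \<beta> t = (cent (x t))\<^sup>2 + (cent (y t))\<^sup>2" for t by (simp add: sqlen_def x_def y_def)
  have xd: "x (t - u) = x t - x u" "y (t - u) = y t - y u" for t u
    by (simp_all add: x_def y_def left_diff_distrib)
  note r = r[unfolded xdef] and k = k[unfolded xdef] and i = i[unfolded xdef]
  have k0: "0 < k" using isolated_diff_range[OF k(1)] by simp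
  obtain s1 where s1: "\<And>t. 0 < t \<Longrightarrow> sqlen \<alpha> \<beta> t < sqlen \<alpha> \<beta> r \<Longrightarrow> regular (x t) \<Longrightarrow>
       int n + 1 + (if s1 = (cent (x t) > 0) then r else - r) \<le> 2 * t"
    using isolated_diff_bound[of \<alpha> \<beta> n r] r unfolding xdef by blast
  obtain s2 where s2: "\<And>t. 0 < t \<Longrightarrow> sqlen \<alpha> \<beta> t < sqlen \<alpha> \<beta> r \<Longrightarrow> regular (y t) \<Longrightarrow>
       int n + 1 + (if s2 = (cent (y t) > 0) then r else - r) \<le> 2 * t"
    using isolated_diff_bound[OF isolated_diff_swap[OF r(1)]] r(3)
    unfolding xdef sqlen_swap[of \<beta> \<alpha>] by blast
  \<comment> \<open>If the smaller coordinate had size one half, both would. The larger coordinate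
    \<open>x\<close> may still be one half.\<close>
  have short: "cent (y t) \<noteq> - 1 / 2"
    if "sqlen \<alpha> \<beta> t < sqlen \<alpha> \<beta> r" "\<bar>cent (y t)\<bar> \<le> \<bar>cent (x t)\<bar>" for t
    using that sqlen_not_both_half[OF that(1)] abs_cent_le_half[of "x t"] abs_cent_half[of "x t"]
    unfolding xdef by force
  have ir: "sqlen \<alpha> \<beta> i < sqlen \<alpha> \<beta> r" using less by simp
  have yk: "regular (y k)" "s2 \<noteq> (cent (y k) > 0)" and yi: "regular (y i)" "s2 \<noteq> (cent (y i) > 0)"
    using short[OF less(2) k(5)] short[OF ir i(5)] s2[OF k0 less(2)] s2[OF i(1) ir] k i by (auto split: if_splits)
  have xk: "cent (x k) \<noteq> - 1 / 2 \<Longrightarrow> s1 \<noteq> (cent (x k) > 0)"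
    and xi: "cent (x i) \<noteq> - 1 / 2 \<Longrightarrow> s1 \<noteq> (cent (x i) > 0)"
    using s1[OF k0 less(2)] s1[OF i(1) ir] k i by (auto split: if_splits)
  obtain s where s: "cent (y k) \<noteq> - 1 / 2 \<longrightarrow> s = (cent (y k) > 0)"
    "\<And>t. 0 < t \<Longrightarrow> sqlen \<alpha> \<beta> t < sqlen \<alpha> \<beta> k \<Longrightarrow> regular (y t) \<Longrightarrow>
       int n + 1 + (if s = (cent (y t) > 0) then k else - k) \<le> 2 * t"
    using isolated_diff_bound[OF isolated_diff_swap[OF k(1)]] k(3)
    unfolding xdef sqlen_swap[of \<beta> \<alpha>] by blast
  have "int n + 1 + k \<le> 2 * i"
    using s(2)[OF i(1) less(1) yi(1)] s(1) yk yi by auto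
  then have ik: "k < i" "0 < i - k" "2 * (i - k) < int n + r + 1"
    using i(4) isolated_diff_range[OF k(1)] by auto
  have py: "cent (y i - y k) = cent (y i) - cent (y k)"
    "\<bar>cent (y i) - cent (y k)\<bar> = \<bar>\<bar>cent (y i)\<bar> - \<bar>cent (y k)\<bar>\<bar>"
    "(cent (y i) - cent (y k) > 0) = (if s2 then \<bar>cent (y i)\<bar> < \<bar>cent (y k)\<bar> else \<bar>cent (y k)\<bar> < \<bar>cent (y i)\<bar>)"
  proof -
    have "\<bar>cent (y i) - cent (y k)\<bar> < 1 / 2"
      using yk yi by (intro abs_diff_less_if_same_sign abs_cent_less_half) auto
    then show "cent (y i - y k) = cent (y i) - cent (y k)" by (rule cent_diff)
    show "\<bar>cent (y i) - cent (y k)\<bar> = \<bar>\<bar>cent (y i)\<bar> - \<bar>cent (y k)\<bar>\<bar>"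
      "(cent (y i) - cent (y k) > 0) = (if s2 then \<bar>cent (y i)\<bar> < \<bar>cent (y k)\<bar> else \<bar>cent (y k)\<bar> < \<bar>cent (y i)\<bar>)"
      using yk yi by auto
  qed
  \<comment> \<open>\<open>g\<close> is the sign opposite to \<open>s1\<close>. A coordinate of size
    one half is represented by \<open>g / 2\<close> instead of -1/2, so that both first coordinates
    lie on one side and can be subtracted.\<close>
  define g where "g = (if s1 then -1 else 1 :: real)"
  have "\<exists>l. x t = g * \<bar>cent (x t)\<bar> + of_int l"
    if "cent (x t) \<noteq> - 1 / 2 \<Longrightarrow> s1 \<noteq> (cent (x t) > 0)" "cent (x t) \<noteq> 0" for t
  proof -
    obtain l where l: "x t = cent (x t) + of_int l" by (rule cent_expand)
    show ?thesis
    proof (cases "cent (x t) = - 1 / 2 \<and> \<not> s1")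
      case True
      then show ?thesis using l by (intro exI[of _ "l - 1"]) (simp add: g_def)
    next
      case False
      then have "cent (x t) = g * \<bar>cent (x t)\<bar>"
        using that by (cases "cent (x t) = - 1 / 2") (auto simp: g_def)
      then show ?thesis using l by (intro exI[of _ l]) simp
    qed
  qed
  from this[OF xi i(2)] this[OF xk k(2)] obtain l l' where
    "x i = g * \<bar>cent (x i)\<bar> + of_int l" "x k = g * \<bar>cent (x k)\<bar> + of_int l'" by auto
  then have e: "x i - x k = g * (\<bar>cent (x i)\<bar> - \<bar>cent (x k)\<bar>) + of_int (l - l')"
    by (simp add: algebra_simps)
  have lt: "\<bar>\<bar>cent (x i)\<bar> - \<bar>cent (x k)\<bar>\<bar> < 1 / 2"
    using i(2) k(2) abs_cent_le_half[of "x i"] abs_cent_le_half[of "x k"] by linarith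
  have px: "cent (x i - x k) = g * (\<bar>cent (x i)\<bar> - \<bar>cent (x k)\<bar>)"
  proof (rule cent_unique[OF e])
    have "\<bar>g * (\<bar>cent (x i)\<bar> - \<bar>cent (x k)\<bar>)\<bar> < 1 / 2" using lt by (simp add: g_def abs_mult)
    then show "- 1 / 2 \<le> g * (\<bar>cent (x i)\<bar> - \<bar>cent (x k)\<bar>)" "g * (\<bar>cent (x i)\<bar> - \<bar>cent (x k)\<bar>) < 1 / 2"
      by linarith+
  qed
  have gg: "g\<^sup>2 = 1" by (simp add: g_def)
  have sqd: "sqlen \<alpha> \<beta> (i - k) = (\<bar>cent (x i)\<bar> - \<bar>cent (x k)\<bar>)\<^sup>2 + (\<bar>cent (y i)\<bar> - \<bar>cent (y k)\<bar>)\<^sup>2"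
    unfolding sql xd px py(1) power_mult_distrib gg
    using arg_cong[OF py(2), of "\<lambda>z. z\<^sup>2"] by simp
  have "sqlen \<alpha> \<beta> (i - k) < sqlen \<alpha> \<beta> k"
    unfolding sqd using octant_diff_less[of "\<bar>cent (x i)\<bar>" "\<bar>cent (y i)\<bar>" "\<bar>cent (x k)\<bar>" "\<bar>cent (y k)\<bar>"]
      i k less(1) by (simp add: sql)
  then have sh: "sqlen \<alpha> \<beta> (i - k) < sqlen \<alpha> \<beta> r" using less by simp
  \<comment> \<open>Otherwise \<open>i - k\<close> would point in the direction of \<open>r\<close>,
    forcing \<open>2 * (i - k) \<ge> n + 1 + r\<close>.\<close>
  have "\<bar>cent (x k)\<bar> \<le> \<bar>cent (x i)\<bar>"
  proof (rule ccontr)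
    assume n: "\<not> ?thesis"
    then have "regular (x (i - k))" "s1 = (cent (x (i - k)) > 0)"
      using lt unfolding xd px by (auto simp: g_def)
    from s1[OF ik(2) sh this(1)] this(2) ik(3) show False by simp
  qed
  moreover have "\<bar>cent (y k)\<bar> \<le> \<bar>cent (y i)\<bar>"
  proof (rule ccontr)
    assume n: "\<not> ?thesis"
    have "regular (y (i - k))"
      using n yk yi abs_cent_less_half[of "y i"] abs_cent_less_half[of "y k"] py(2)
      unfolding xd py(1) by auto
    moreover have "s2 = (cent (y (i - k)) > 0)" using n unfolding xd py(1) py(3) by simp
    ultimately show False using s2[OF ik(2) sh] ik(3) by simp
  qed
  ultimately have "(cent (x k))\<^sup>2 \<le> (cent (x i))\<^sup>2" "(cent (y k))\<^sup>2 \<le> (cent (y i))\<^sup>2"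
    by (simp_all add: abs_le_square_iff)
  then show False using less(1) by (simp add: sql)
qed

section \<open>Counting\<close>

lemma obtain_strict_max:
  fixes f :: "'a \<Rightarrow> 'b::linorder"
  assumes "finite A" "A \<noteq> {}" "inj_on f A"
  obtains r where "r \<in> A" "\<And>m. m \<in> A - {r} \<Longrightarrow> f m < f r"
proof -
  have "Max (f ` A) \<in> f ` A" using assms by (intro Max_in) auto
  then obtain r where r: "r \<in> A" "Max (f ` A) = f r" by auto
  have "f m < f r" if "m \<in> A - {r}" for m
  proof -
    have "f m \<le> f r" using assms that by (simp flip: r(2))
    moreover have "f m \<noteq> f r" using assms that r by (auto dest: inj_onD)
    ultimately show ?thesis by simp
  qed
  then show ?thesis using r that by blast
qed

text \<open>Allows one to assume that, of two elements with the same label, the first is strictly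
  shorter.\<close>

lemma inj_onI_less:
  fixes f :: "'a \<Rightarrow> 'b::linorder"
  assumes "inj_on f A"
    and "\<And>x y. x \<in> A \<Longrightarrow> y \<in> A \<Longrightarrow> f x < f y \<Longrightarrow> g x = g y \<Longrightarrow> False"
  shows "inj_on g A"
proof (rule inj_onI, rule ccontr)
  fix x y assume "x \<in> A" "y \<in> A" "g x = g y" "x \<noteq> y"
  moreover from this have "f x \<noteq> f y" using assms(1) by (auto dest: inj_onD)
  ultimately show False using assms(2)[of x y] assms(2)[of y x] by (auto simp: neq_iff)
qed

lemma sqlen_abs: "sqlen \<alpha> \<beta> \<bar>t\<bar> = sqlen \<alpha> \<beta> t"
  by (simp add: abs_if sqlen_minus)

lemma abs_cent_abs: "\<bar>cent (of_int \<bar>t\<bar> * x)\<bar> = \<bar>cent (of_int t * x)\<bar>"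
  using abs_cent_minus[of "of_int t * x"] by (cases "t < 0") simp_all

lemma cent_abs_eq_0: "cent (of_int \<bar>t\<bar> * x) = 0 \<longleftrightarrow> cent (of_int t * x) = 0"
  using abs_cent_abs[of t x] by linarith

text \<open>Reduction modulo 1 only shortens a difference, so the planar estimate carries over; the
  absolute value makes the step nonnegative.\<close>

lemma sector_short:
  assumes "sector (cent (of_int i * \<alpha>)) (cent (of_int i * \<beta>)) = sector (cent (of_int k * \<alpha>)) (cent (of_int k * \<beta>))"
    "sqlen \<alpha> \<beta> i < R" "sqlen \<alpha> \<beta> k < R"
  shows "sqlen \<alpha> \<beta> \<bar>i - k\<bar> < R"
  using sqlen_diff_le[of \<alpha> \<beta> i k] sector_diff_less[OF assms(1), of R] assms(2,3)
  unfolding sqlen_abs by (simp add: sqlen_def)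

lemma cent_diff_zero: "cent x = 0 \<Longrightarrow> cent y = 0 \<Longrightarrow> cent (x - y) = 0"
  using cent_diff[of x y] by simp

lemma cent_mult_zero: "cent x = 0 \<Longrightarrow> cent (of_int k * x) = 0"
proof -
  assume "cent x = 0"
  then obtain l where "x = of_int l" using cent_zero_int by auto
  then show ?thesis by (intro cent_unique[of _ _ "k * l"]) auto
qed

text \<open>Both numbers lie in the open interval from (n + r) / 2 to n, of length (n - r) /
  2.\<close>

lemma int_abs_diff_less:
  fixes i k n r :: int
  assumes "n + r < 2 * i" "i < n" "n + r < 2 * k" "k < n"
  shows "2 * \<bar>i - k\<bar> < n - r"
proof -
  have "2 * (i - k) < n - r" "2 * (k - i) < n - r"
    using assms by presburger+
  then show ?thesis by (simp add: abs_if)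
qed

text \<open>On the multiples with vanishing first coordinate the problem is one-dimensional, and the bound 3
  is that of the three gap theorem.\<close>

lemma card_zero_class:
  assumes fin: "finite Z" and inj: "inj_on (sqlen \<alpha> \<beta>) Z"
    and Z: "\<And>m. m \<in> Z \<Longrightarrow> isolated_diff \<alpha> \<beta> n m \<and> cent (of_int m * \<alpha>) = 0"
  shows "card Z \<le> 3"
proof (cases "Z = {}")
  case False
  obtain r where r: "r \<in> Z" "\<And>m. m \<in> Z - {r} \<Longrightarrow> sqlen \<alpha> \<beta> m < sqlen \<alpha> \<beta> r"
    using obtain_strict_max[OF fin False inj] by blast
  define B where "B = Z - {r}"
  have cB: "card Z = Suc (card B)" using fin r(1) unfolding B_def by (rule card.remove)
  have injB: "inj_on (sqlen \<alpha> \<beta>) B"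
    using inj by (auto simp: B_def intro: inj_on_subset)
  define y where "y = (\<lambda>t::int. cent (of_int t * \<beta>))"
  have sq: "sqlen \<alpha> \<beta> t < sqlen \<alpha> \<beta> u \<longleftrightarrow> \<bar>y t\<bar> < \<bar>y u\<bar>"
    if "cent (of_int t * \<alpha>) = 0" "cent (of_int u * \<alpha>) = 0" for t u
    using that abs_le_square_iff[of "y u" "y t"] by (auto simp: sqlen_def y_def not_le[symmetric])
  have za: "cent (of_int (t - u) * \<alpha>) = 0"
    if "cent (of_int t * \<alpha>) = 0" "cent (of_int u * \<alpha>) = 0" for t u
    using cent_diff_zero[OF that] by (simp add: left_diff_distrib)
  have bound: "\<exists>s. (y m \<noteq> - 1 / 2 \<longrightarrow> s = (y m > 0)) \<and> (\<forall>t. 0 < t \<and> cent (of_int t * \<alpha>) = 0 \<and> y t \<noteq> 0 \<and> \<bar>y t\<bar> < \<bar>y m\<bar> \<longrightarrow>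
      int n + 1 + (if s = (y t > 0) then m else - m) \<le> 2 * t)" if m: "m \<in> Z" "y m \<noteq> 0" for m
  proof -
    have reg: "y t \<noteq> - 1 / 2" if "\<bar>y t\<bar> < \<bar>y m\<bar>" for t
      using that abs_cent_le_half[of "of_int m * \<beta>"] by (auto simp: y_def)
    have m': "isolated_diff \<beta> \<alpha> n m" "cent (of_int m * \<alpha>) = 0"
      using Z[OF m(1)] isolated_diff_swap by auto
    obtain s where s: "y m \<noteq> - 1 / 2 \<longrightarrow> s = (y m > 0)"
      "\<And>t. 0 < t \<Longrightarrow> sqlen \<alpha> \<beta> t < sqlen \<alpha> \<beta> m \<Longrightarrow> y t \<noteq> 0 \<Longrightarrow> y t \<noteq> - 1 / 2 \<Longrightarrow>
         int n + 1 + (if s = (y t > 0) then m else - m) \<le> 2 * t"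
      using isolated_diff_bound[OF m'(1)] m(2) unfolding y_def sqlen_swap[of \<beta> \<alpha>] by blast
    show ?thesis
      by (rule exI[of _ s]) (use s reg sq[OF _ m'(2)] in blast)
  qed
  have B: "isolated_diff \<alpha> \<beta> n m" "cent (of_int m * \<alpha>) = 0" "\<bar>y m\<bar> < \<bar>y r\<bar>" "0 < m" "m < int n"
    if "m \<in> B" for m
    using that Z r sq[of m r] isolated_diff_range[of \<alpha> \<beta> n m] by (auto simp: B_def)
  have "card B \<le> 2"
  proof (cases "B = {}")
    case False
    then have yr: "y r \<noteq> 0" using B(3) by fastforce
    obtain s where s: "\<And>t. 0 < t \<Longrightarrow> cent (of_int t * \<alpha>) = 0 \<Longrightarrow> y t \<noteq> 0 \<Longrightarrow> \<bar>y t\<bar> < \<bar>y r\<bar> \<Longrightarrow>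
      int n + 1 + (if s = (y t > 0) then r else - r) \<le> 2 * t"
      using bound[OF r(1) yr] by blast
    show ?thesis
    proof (cases "\<exists>z\<in>B. y z = 0")
      case True
      then obtain z where z: "z \<in> B" "y z = 0" by blast
      have "i = z" if i: "i \<in> B" for i
      proof (rule ccontr)
        assume "i \<noteq> z"
        then have "y i \<noteq> 0"
          using z i B(2) inj_onD[OF injB, of i z] by (auto simp: sqlen_def y_def)
        \<comment> \<open>\<open>z\<close> is a common period, so \<open>t\<close> has the
          displacement of \<open>i\<close> and \<open>z - t\<close> the opposite one. One of them
          points with \<open>r\<close>, the other against it; the two bounds add up to
          \<open>2 * z \<ge> 2 * n + 2\<close>.\<close>
        define t where "t = i mod z"
        have eq: "i = t + i div z * z" by (simp add: t_def)
        have "cent (of_int (i div z) * (of_int z * \<beta>)) = 0" "cent (of_int (i div z) * (of_int z * \<alpha>)) = 0"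
          using z B(2)[OF z(1)] by (auto intro!: cent_mult_zero simp: y_def)
        from this[THEN cent_add_left_zero]
        have "cent (of_int (i div z) * (of_int z * x) + of_int t * x) = cent (of_int t * x)" if "x \<in> {\<alpha>, \<beta>}" for x
          using that by auto
        moreover have "of_int (i div z) * (of_int z * x) + of_int t * x = of_int i * x" for x :: real
          by (subst (2) eq, unfold of_int_add of_int_mult) (simp add: algebra_simps)
        ultimately have "cent (of_int t * \<alpha>) = cent (of_int i * \<alpha>)" "y t = y i"
          by (simp_all add: y_def)
        then have t: "cent (of_int t * \<alpha>) = 0" "y t = y i" using B(2)[OF i] by auto
        have "t \<noteq> 0" using t \<open>y i \<noteq> 0\<close> cent_unique[of 0 0 0] by (auto simp: y_def)
        then have t0: "0 < t" "0 < z - t" 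
          using pos_mod_sign[OF B(4)[OF z(1)], of i] pos_mod_bound[OF B(4)[OF z(1)], of i]
          unfolding t_def by linarith+
        have h: "y t \<noteq> - 1 / 2"
          using t B(3)[OF i] abs_cent_le_half[of "of_int r * \<beta>"] by (auto simp: y_def)
        have "cent (of_int z * \<beta> + - (of_int t * \<beta>)) = cent (- (of_int t * \<beta>))"
          using z by (intro cent_add_left_zero) (simp add: y_def)
        then have "y (z - t) = - y t" using cent_minus[of "of_int t * \<beta>"] h
          by (simp add: y_def left_diff_distrib)
        then show False
          using s[OF t0(1) t(1)] s[OF t0(2) za[OF B(2)[OF z(1)] t(1)]] t \<open>y i \<noteq> 0\<close> B(3)[OF i] B(5)[OF z(1)]
          by (auto split: if_splits)
      qed
      then have "B \<subseteq> {z}" by auto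
      then have "card B \<le> card {z}" by (intro card_mono) auto
      then show ?thesis by simp
    next
      case nz: False
      have "inj_on (\<lambda>m. 0 < y m) B"
      proof (rule inj_onI_less[OF injB])
        fix i k assume i: "i \<in> B" and k: "k \<in> B" and ik: "sqlen \<alpha> \<beta> i < sqlen \<alpha> \<beta> k"
          and sg: "(0 < y i) = (0 < y k)"
        have nzi: "y i \<noteq> 0" "y k \<noteq> 0" using nz i k by auto
        have ik: "\<bar>y i\<bar> < \<bar>y k\<bar>" using ik sq B(2) i k by simp
        have kZ: "k \<in> Z" using k by (simp add: B_def)
        have kh: "\<bar>y k\<bar> < 1 / 2" using B(3)[OF k] abs_cent_le_half[of "of_int r * \<beta>"] by (simp add: y_def)
        have ineq: "\<bar>y i - y k\<bar> < \<bar>y k\<bar>" "y i - y k \<noteq> 0" "(0 < y i - y k) \<noteq> (0 < y k)"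
          using ik nzi sg by (auto simp: abs_if split: if_splits)
        have d: "y (i - k) = y i - y k"
          using cent_diff[of "of_int i * \<beta>" "of_int k * \<beta>"] ineq kh by (simp add: y_def left_diff_distrib)
        have ad: "\<bar>y \<bar>i - k\<bar>\<bar> = \<bar>y i - y k\<bar>" using abs_cent_abs[of "i - k" \<beta>] d by (simp add: y_def)
        have zd: "cent (of_int \<bar>i - k\<bar> * \<alpha>) = 0"
          using za[OF B(2)[OF i] B(2)[OF k]] by (rule iffD2[OF cent_abs_eq_0])
        show False
        proof (cases "s = (0 < y i)")
          case True
          then have "int n + r < 2 * i" "int n + r < 2 * k"
            using s[of i] s[of k] B[OF i] B[OF k] nzi sg by auto
          then have "2 * \<bar>i - k\<bar> < int n - r" using B(5)[OF i] B(5)[OF k] by (intro int_abs_diff_less)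
          moreover have "0 < \<bar>i - k\<bar>" using ik by auto
          moreover have "y \<bar>i - k\<bar> \<noteq> 0" "\<bar>y \<bar>i - k\<bar>\<bar> < \<bar>y r\<bar>" using ad ineq B(3)[OF k] by auto
          moreover have "0 < r" using isolated_diff_range[of \<alpha> \<beta> n r] Z[OF r(1)] by simp
          ultimately show False using s[OF _ zd] by (smt (verit))
        next
          case False
          \<comment> \<open>Isolation of \<open>k\<close> gives \<open>i > k\<close>. As
            \<open>i\<close> is shorter, \<open>i - k\<close> points against \<open>k\<close>, hence
            with \<open>r\<close>; adding the bounds for \<open>i - k\<close> and \<open>k\<close>
            yields \<open>i > n\<close>.\<close>
          obtain s' where s': "y k \<noteq> - 1 / 2 \<longrightarrow> s' = (y k > 0)"
            "\<And>t. 0 < t \<Longrightarrow> cent (of_int t * \<alpha>) = 0 \<Longrightarrow> y t \<noteq> 0 \<Longrightarrow> \<bar>y t\<bar> < \<bar>y k\<bar> \<Longrightarrow>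
               int n + 1 + (if s' = (y t > 0) then k else - k) \<le> 2 * t"
            using bound[OF kZ nzi(2)] by blast
          have "int n + 1 + k \<le> 2 * i"
            using s'(2)[of i] s'(1) kh B[OF i] nzi ik sg by auto
          then have "0 < i - k" using B(5)[OF k] by simp
          moreover have "int n + 1 - r \<le> 2 * k"
            using s[of k] B[OF k] nzi False sg by auto
          moreover have "int n + 1 + r \<le> 2 * (i - k)"
            using s[OF \<open>0 < i - k\<close> za[OF B(2)[OF i] B(2)[OF k]]] d ineq False sg B(3)[OF k] by auto
          ultimately show False using B(5)[OF i] by simp
        qed
      qed
      then have "card B \<le> card (UNIV :: bool set)" by (intro card_inj_on_le) auto
      then show ?thesis by simp
    qed
  qed simp
  then show ?thesis using cB by simp
qed simp

text \<open>The count is the longest element, at most one further element with first coordinate one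
  half, and one element per sector.\<close>

lemma card_nonzero_class:
  assumes fin: "finite P" and inj: "inj_on (sqlen \<alpha> \<beta>) P"
    and P: "\<And>m. m \<in> P \<Longrightarrow> isolated_diff \<alpha> \<beta> n m \<and> cent (of_int m * \<alpha>) \<noteq> 0"
    and q: "0 < q" "cent (of_int q * \<alpha>) = 0" "2 * q < int n"
    and qmin: "\<And>t. 0 < t \<Longrightarrow> t < q \<Longrightarrow> cent (of_int t * \<alpha>) \<noteq> 0"
  shows "card P \<le> 8"
proof (cases "P = {}")
  case False
  obtain r where r: "r \<in> P" "\<And>m. m \<in> P - {r} \<Longrightarrow> sqlen \<alpha> \<beta> m < sqlen \<alpha> \<beta> r"
    using obtain_strict_max[OF fin False inj] by blast
  define W where "W = {m \<in> P - {r}. cent (of_int m * \<alpha>) = - 1 / 2}"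
  define Y where "Y = {m \<in> P - {r}. cent (of_int m * \<alpha>) \<noteq> - 1 / 2}"
  have "P = insert r (W \<union> Y)" using r(1) by (auto simp: W_def Y_def)
  moreover have "card (insert r (W \<union> Y)) \<le> Suc (card W + card Y)"
    using card_insert_le_m1[of "Suc (card W + card Y)" "W \<union> Y" r] card_Un_le[of W Y] by simp
  moreover have "card W \<le> 1"
  proof -
    have "x = y" if "x \<in> W" "y \<in> W" for x y
      using that isolated_diff_half_unique[of \<alpha> \<beta> n x y] P inj_onD[OF inj, of x y] by (auto simp: W_def)
    then show ?thesis using card_le_Suc0_iff_eq[of W] fin by (auto simp: W_def)
  qed
  moreover have "card Y \<le> 6"
  proof -
    have Y: "int n - q < m" "m < int n" "sqlen \<alpha> \<beta> m < sqlen \<alpha> \<beta> r"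
      "cent (of_int m * \<alpha>) \<noteq> - 1 / 2" if "m \<in> Y" for m
      using that isolated_diff_period_bound[of \<alpha> \<beta> n r q m] P[of r] P[of m] r q isolated_diff_range[of \<alpha> \<beta> n m]
      by (auto simp: Y_def)
    have injY: "inj_on (sqlen \<alpha> \<beta>) Y" using inj by (rule inj_on_subset) (auto simp: Y_def)
    have "inj_on (\<lambda>m. sector (cent (of_int m * \<alpha>)) (cent (of_int m * \<beta>))) Y"
    proof (rule inj_onI_less[OF injY])
      fix i k assume i: "i \<in> Y" and k: "k \<in> Y" and ik: "sqlen \<alpha> \<beta> i < sqlen \<alpha> \<beta> k"
        and s: "sector (cent (of_int i * \<alpha>)) (cent (of_int i * \<beta>)) = sector (cent (of_int k * \<alpha>)) (cent (of_int k * \<beta>))"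
      have "i \<noteq> k" using ik by auto
      \<comment> \<open>Both elements lie strictly between \<open>n - q\<close> and
        \<open>n\<close>. Minimality of \<open>q\<close> makes the first coordinate of their
        difference nonzero, so this short difference would have to exceed \<open>n - q\<close>,
        which is more than \<open>q\<close>.\<close>
      then have t: "0 < \<bar>i - k\<bar>" "\<bar>i - k\<bar> < q" using Y(1,2)[OF i] Y(1,2)[OF k] by auto
      have nz: "cent (of_int \<bar>i - k\<bar> * \<alpha>) \<noteq> 0" using qmin[OF t] .
      \<comment> \<open>A sector fixes the sign of the first coordinate, so the difference of two
        such coordinates cannot reach one half.\<close>
      have "(0 < cent (of_int i * \<alpha>)) = (0 < cent (of_int k * \<alpha>))" using s by (simp add: sector_def)
      then have lt: "\<bar>cent (of_int i * \<alpha>) - cent (of_int k * \<alpha>)\<bar> < 1 / 2"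
        using Y(4) i k by (intro abs_diff_less_if_same_sign abs_cent_less_half) auto
      have "cent (of_int \<bar>i - k\<bar> * \<alpha>) \<noteq> - 1 / 2"
        using abs_cent_abs[of "i - k" \<alpha>] cent_diff[OF lt] lt by (auto simp: left_diff_distrib)
      then have "int n - q < \<bar>i - k\<bar>"
        using isolated_diff_period_bound[of \<alpha> \<beta> n r q] P[OF r(1)] q nz t
          sector_short[OF s Y(3)[OF i] Y(3)[OF k]] by blast
      then show False using t q by simp
    qed
    then have "card Y \<le> card sectors"
      using card_sectors sector_in_sectors by (intro card_inj_on_le) auto
    then show ?thesis using card_sectors by simp
  qed
  ultimately show ?thesis by simp
qed simp

lemma card_generic_class:
  assumes fin: "finite P" and inj: "inj_on (sqlen \<alpha> \<beta>) P"
    and P: "\<And>m. m \<in> P \<Longrightarrow> isolated_diff \<alpha> \<beta> n m \<and> cent (of_int m * \<alpha>) \<noteq> 0 \<and> cent (of_int m * \<beta>) \<noteq> 0"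
    and np: "\<And>t. 0 < t \<Longrightarrow> 2 * t < int n \<Longrightarrow> cent (of_int t * \<alpha>) \<noteq> 0 \<and> cent (of_int t * \<beta>) \<noteq> 0"
  shows "card P \<le> 9"
proof (cases "P = {}")
  case False
  obtain r where r: "r \<in> P" "\<And>m. m \<in> P - {r} \<Longrightarrow> sqlen \<alpha> \<beta> m < sqlen \<alpha> \<beta> r"
    using obtain_strict_max[OF fin False inj] by blast
  have r0: "0 < r" using P[OF r(1)] isolated_diff_range by blast
  define B where "B = {m \<in> P - {r}. int n + r < 2 * m}"
  \<comment> \<open>These elements violate the bound for a shared direction, so all their regular
    coordinates point against \<open>r\<close>.\<close>
  define X where "X = {m \<in> P - {r}. 2 * m \<le> int n + r}"
  have "P = insert r (B \<union> X)" using r(1) by (auto simp: B_def X_def)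
  moreover have "card (insert r (B \<union> X)) \<le> Suc (card B + card X)"
    using card_insert_le_m1[of "Suc (card B + card X)" "B \<union> X" r] card_Un_le[of B X] by simp
  moreover have "card B \<le> 6"
  proof -
    have B: "int n + r < 2 * m" "m < int n" "sqlen \<alpha> \<beta> m < sqlen \<alpha> \<beta> r" if "m \<in> B" for m
      using that P[of m] r isolated_diff_range[of \<alpha> \<beta> n m] by (auto simp: B_def)
    have injB: "inj_on (sqlen \<alpha> \<beta>) B" using inj by (rule inj_on_subset) (auto simp: B_def)
    have "inj_on (\<lambda>m. sector (cent (of_int m * \<alpha>)) (cent (of_int m * \<beta>))) B"
    proof (rule inj_onI_less[OF injB])
      fix i k assume i: "i \<in> B" and k: "k \<in> B" and ik: "sqlen \<alpha> \<beta> i < sqlen \<alpha> \<beta> k"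
        and s: "sector (cent (of_int i * \<alpha>)) (cent (of_int i * \<beta>)) = sector (cent (of_int k * \<alpha>)) (cent (of_int k * \<beta>))"
      have "i \<noteq> k" using ik by auto
      then have t: "0 < \<bar>i - k\<bar>" "2 * \<bar>i - k\<bar> < int n - r"
        using int_abs_diff_less[OF B(1,2)[OF i] B(1,2)[OF k]] by auto
      have "int n + 1 - r \<le> 2 * \<bar>i - k\<bar>"
        using short_multiple_bound[of \<alpha> \<beta> n r "\<bar>i - k\<bar>"] P[OF r(1)] np[of "\<bar>i - k\<bar>"] t r0
          sector_short[OF s B(3)[OF i] B(3)[OF k]] by auto
      then show False using t by simp
    qed
    then have "card B \<le> card sectors"
      using card_sectors sector_in_sectors by (intro card_inj_on_le) auto
    then show ?thesis using card_sectors by simp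
  qed
  moreover have "card X \<le> 2"
  proof -
    have injX: "inj_on (sqlen \<alpha> \<beta>) X" using inj by (rule inj_on_subset) (auto simp: X_def)
    \<comment> \<open>The quadrant being fixed, comparing the sizes of the coordinates selects one
      of its two octants.\<close>
    have "inj_on (\<lambda>m. \<bar>cent (of_int m * \<beta>)\<bar> \<le> \<bar>cent (of_int m * \<alpha>)\<bar>) X"
    proof (rule inj_onI_less[OF injX])
      fix i k assume i: "i \<in> X" and k: "k \<in> X" and ik: "sqlen \<alpha> \<beta> i < sqlen \<alpha> \<beta> k"
        and s: "(\<bar>cent (of_int i * \<beta>)\<bar> \<le> \<bar>cent (of_int i * \<alpha>)\<bar>) = (\<bar>cent (of_int k * \<beta>)\<bar> \<le> \<bar>cent (of_int k * \<alpha>)\<bar>)"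
      have i': "i \<in> P" "2 * i \<le> int n + r" and k': "k \<in> P" "2 * k \<le> int n + r" "sqlen \<alpha> \<beta> k < sqlen \<alpha> \<beta> r"
        using i k r by (auto simp: X_def)
      have i0: "0 < i" using P[OF i'(1)] isolated_diff_range by blast
      show False
      proof (cases "\<bar>cent (of_int i * \<beta>)\<bar> \<le> \<bar>cent (of_int i * \<alpha>)\<bar>")
        case True
        then show False using octant_absurd[of \<alpha> \<beta> n r k i] P r i' k' i0 ik s by blast
      next
        case False
        then have "\<bar>cent (of_int i * \<alpha>)\<bar> \<le> \<bar>cent (of_int i * \<beta>)\<bar>" "\<bar>cent (of_int k * \<alpha>)\<bar> \<le> \<bar>cent (of_int k * \<beta>)\<bar>"
          using s by auto
        then show False using octant_absurd[of \<beta> \<alpha> n r k i] P r i' k' i0 ik isolated_diff_swap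
          unfolding sqlen_swap[of \<beta> \<alpha>] by blast
      qed
    qed
    then have "card X \<le> card (UNIV :: bool set)" by (intro card_inj_on_le) auto
    then show ?thesis by simp
  qed
  ultimately show ?thesis by simp
qed simp

lemma card_isolated_periodic:
  assumes fin: "finite P" and inj: "inj_on (sqlen \<alpha> \<beta>) P"
    and P: "\<And>m. m \<in> P \<Longrightarrow> isolated_diff \<alpha> \<beta> n m"
    and t: "0 < t" "2 * t < int n" "cent (of_int t * \<alpha>) = 0"
  shows "card P \<le> 11"
proof -
  \<comment> \<open>The least period is taken, so that all smaller steps have nonzero first
    coordinate.\<close>
  define k where "k = (LEAST k::nat. 0 < k \<and> cent (of_int (int k) * \<alpha>) = 0)"
  have ex: "0 < nat t \<and> cent (of_int (int (nat t)) * \<alpha>) = 0" using t by simp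
  have k: "0 < k \<and> cent (of_int (int k) * \<alpha>) = 0" 
    unfolding k_def by (rule LeastI[where P = "\<lambda>k. 0 < k \<and> cent (of_int (int k) * \<alpha>) = 0", OF ex])
  have "k \<le> nat t" 
    unfolding k_def by (rule Least_le[where P = "\<lambda>k. 0 < k \<and> cent (of_int (int k) * \<alpha>) = 0", OF ex])
  then have kn: "2 * int k < int n" using t by simp
  have kmin: "cent (of_int u * \<alpha>) \<noteq> 0" if "0 < u" "u < int k" for u
    using that not_less_Least[of "nat u" "\<lambda>k. 0 < k \<and> cent (of_int (int k) * \<alpha>) = 0", folded k_def]
    by simp
  define Z where "Z = {m \<in> P. cent (of_int m * \<alpha>) = 0}"
  define N where "N = {m \<in> P. cent (of_int m * \<alpha>) \<noteq> 0}"
  have "card Z \<le> 3"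
    by (rule card_zero_class[of _ \<alpha> \<beta> n]) (use fin inj P in \<open>auto simp: Z_def intro: inj_on_subset\<close>)
  moreover have "card N \<le> 8"
    by (rule card_nonzero_class[of _ \<alpha> \<beta> n "int k"])
      (use fin inj P k kn kmin in \<open>auto simp: N_def intro: inj_on_subset\<close>)
  moreover have "P = Z \<union> N" by (auto simp: Z_def N_def)
  ultimately show ?thesis using card_Un_le[of Z N] by simp
qed

text \<open>If \<open>x < y\<close> were two periods, then \<open>x\<close> and \<open>y - x\<close>
  would both be at least n / 2, and \<open>y\<close> at least \<open>n\<close>.\<close>

lemma card_long_period:
  assumes P: "\<And>m. m \<in> P \<Longrightarrow> 0 < m \<and> m < int n" and fin: "finite P"
    and np: "\<And>t. 0 < t \<Longrightarrow> 2 * t < int n \<Longrightarrow> cent (of_int t * \<theta>) \<noteq> 0"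
  shows "card {m \<in> P. cent (of_int m * \<theta>) = 0} \<le> 1"
proof -
  have False if x: "x \<in> P" "cent (of_int x * \<theta>) = 0" and y: "y \<in> P" "cent (of_int y * \<theta>) = 0"
    and xy: "x < y" for x y
  proof -
    have "cent (of_int (y - x) * \<theta>) = 0"
      using cent_diff_zero[OF y(2) x(2)] by (simp add: left_diff_distrib)
    then have "\<not> 2 * (y - x) < int n" "\<not> 2 * x < int n"
      using np[of "y - x"] np[of x] x P[OF x(1)] xy by auto
    then show False using P[OF y(1)] by simp
  qed
  then have "x = y" if "x \<in> {m \<in> P. cent (of_int m * \<theta>) = 0}" "y \<in> {m \<in> P. cent (of_int m * \<theta>) = 0}" for x y
    using that by (metis (mono_tags, lifting) linorder_cases mem_Collect_eq)
  then show ?thesis using card_le_Suc0_iff_eq[of "{m \<in> P. cent (of_int m * \<theta>) = 0}"] fin by simp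
qed

lemma card_isolated:
  assumes fin: "finite P" and inj: "inj_on (sqlen \<alpha> \<beta>) P"
    and P: "\<And>m. m \<in> P \<Longrightarrow> isolated_diff \<alpha> \<beta> n m"
  shows "card P \<le> 11"
proof -
  consider t where "0 < t" "2 * t < int n" "cent (of_int t * \<alpha>) = 0"
    | t where "0 < t" "2 * t < int n" "cent (of_int t * \<beta>) = 0"
    | "\<And>t. 0 < t \<Longrightarrow> 2 * t < int n \<Longrightarrow> cent (of_int t * \<alpha>) \<noteq> 0 \<and> cent (of_int t * \<beta>) \<noteq> 0"
    by blast
  then show ?thesis
  proof cases
    case 1
    then show ?thesis using card_isolated_periodic[OF fin inj P] by blast
  next
    case 2
    have "inj_on (sqlen \<beta> \<alpha>) P" using inj by (simp add: inj_on_def sqlen_swap[of \<beta> \<alpha>])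
    then show ?thesis using card_isolated_periodic[OF fin _ isolated_diff_swap[OF P]] 2 by blast
  next
    case 3
    define Z where "Z = {m \<in> P. cent (of_int m * \<alpha>) = 0}"
    define Z' where "Z' = {m \<in> P. cent (of_int m * \<beta>) = 0}"
    define N where "N = {m \<in> P. cent (of_int m * \<alpha>) \<noteq> 0 \<and> cent (of_int m * \<beta>) \<noteq> 0}"
    have rng: "0 < m \<and> m < int n" if "m \<in> P" for m using P[OF that] by (rule isolated_diff_range)
    have "card Z \<le> 1" "card Z' \<le> 1"
      unfolding Z_def Z'_def by (rule card_long_period[OF rng fin]; use 3 in blast)+
    moreover have "card N \<le> 9"
      by (rule card_generic_class[of _ \<alpha> \<beta> n])
        (use fin inj P 3 in \<open>auto simp: N_def intro: inj_on_subset\<close>)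
    moreover have "P = Z \<union> (Z' \<union> N)" by (auto simp: Z_def Z'_def N_def)
    ultimately show ?thesis using card_Un_le[of Z "Z' \<union> N"] card_Un_le[of Z' N] by simp
  qed
qed

section \<open>From pairs to differences, and the final bound\<close>

lemma isolated_dists_eq: "isolated_dists \<alpha> \<beta> n = (\<lambda>m. sqrt (sqlen \<alpha> \<beta> m)) ` {m. isolated_diff \<alpha> \<beta> n m}"
proof -
  define R where "R p q j k \<longleftrightarrow> orbit_geodesic \<alpha> p q \<inter> orbit_geodesic \<alpha> j k = {} \<and>
    orbit_geodesic \<beta> p q \<inter> orbit_geodesic \<beta> j k = {}" for p q j k
  define C where "C j m \<longleftrightarrow> 1 \<le> j \<and> 0 < m \<and> j + m \<le> int n \<and>
    (\<forall>p t. 1 \<le> p \<and> 0 < t \<and> p + t \<le> int n \<and> sqlen \<alpha> \<beta> t < sqlen \<alpha> \<beta> m \<longrightarrow> R p (p + t) j (j + m))" for j m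
  have C: "(1 \<le> j \<and> j < k \<and> k \<le> int n \<and>
      (\<forall>p q. 1 \<le> p \<and> p < q \<and> q \<le> int n \<and> torus_dist \<alpha> \<beta> p q < torus_dist \<alpha> \<beta> j k \<longrightarrow> R p q j k))
    \<longleftrightarrow> C j (k - j)" (is "?L \<longleftrightarrow> _") for j k
  proof
    assume L: ?L
    then have "R p (p + t) j k"
      if "1 \<le> p \<and> 0 < t \<and> p + t \<le> int n \<and> sqlen \<alpha> \<beta> t < sqlen \<alpha> \<beta> (k - j)" for p t
      using that by (simp add: torus_dist_sqlen)
    then show "C j (k - j)" using L by (simp add: C_def)
  next
    assume M: "C j (k - j)"
    then have "R p q j k"
      if "1 \<le> p \<and> p < q \<and> q \<le> int n \<and> torus_dist \<alpha> \<beta> p q < torus_dist \<alpha> \<beta> j k" for p q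
      using that M[unfolded C_def, THEN conjunct2, THEN conjunct2, THEN conjunct2, rule_format, of p "q - p"]
      by (simp add: torus_dist_sqlen)
    then show ?L using M by (simp add: C_def)
  qed
  have "{sqrt (sqlen \<alpha> \<beta> (k - j)) | j k. C j (k - j)} = (\<lambda>m. sqrt (sqlen \<alpha> \<beta> m)) ` {m. \<exists>j. C j m}"
  proof (intro equalityI subsetI)
    fix x assume "x \<in> (\<lambda>m. sqrt (sqlen \<alpha> \<beta> m)) ` {m. \<exists>j. C j m}"
    then obtain j m where "x = sqrt (sqlen \<alpha> \<beta> m)" "C j m" by auto
    then have "x = sqrt (sqlen \<alpha> \<beta> ((j + m) - j)) \<and> C j ((j + m) - j)" by simp
    then show "x \<in> {sqrt (sqlen \<alpha> \<beta> (k - j)) | j k. C j (k - j)}" by blast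
  qed auto
  moreover have "isolated_dists \<alpha> \<beta> n = {sqrt (sqlen \<alpha> \<beta> (k - j)) | j k. C j (k - j)}"
    unfolding isolated_dists_def R_def[symmetric] unfolding C unfolding torus_dist_sqlen by (rule refl)
  moreover have "isolated_diff \<alpha> \<beta> n m \<longleftrightarrow> (\<exists>j. C j m)" for m
    unfolding isolated_diff_def C_def R_def ..
  ultimately show ?thesis by simp
qed

theorem theorem1:
  fixes \<alpha> \<beta> :: real and n :: nat
  assumes "n \<ge> 1"
  shows "finite (isolated_dists \<alpha> \<beta> n) \<and> card (isolated_dists \<alpha> \<beta> n) \<le> 11"
proof -
  let ?f = "\<lambda>m. sqrt (sqlen \<alpha> \<beta> m)"
  have fin: "finite {m. isolated_diff \<alpha> \<beta> n m}"
    by (rule finite_subset[of _ "{0..int n}"]) (auto dest: isolated_diff_range)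
  \<comment> \<open>One difference is chosen for each distance, which gives the injectivity required
    for counting.\<close>
  obtain P where P: "P \<subseteq> {m. isolated_diff \<alpha> \<beta> n m}" "inj_on ?f P" "isolated_dists \<alpha> \<beta> n = ?f ` P"
    using subset_image_inj[of "isolated_dists \<alpha> \<beta> n" ?f "{m. isolated_diff \<alpha> \<beta> n m}"]
    unfolding isolated_dists_eq by auto
  have finP: "finite P" using P(1) fin by (rule finite_subset)
  have "inj_on (sqlen \<alpha> \<beta>) P" using P(2) by (auto simp: inj_on_def)
  then have "card P \<le> 11" using card_isolated[OF finP] P(1) by blast
  then show ?thesis using finP P by (simp add: card_image)
qed

end
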